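(* Let $\mathbf p=\mathbf u+\mathbf v$ and $\mathbf q=(u+v)(\mathbf u-\mathbf v)=R(\mathbf u-\mathbf v)$, with components $p_i,q_i$ ($i=1,2,3$). The 2-form $\sigma=X\lrcorner\varphi$ on $\mathcal M$ is $$\sigma=-\tfrac12\sum_{i=1}^3dp_i\wedge dq_i,$$ and this is non-degenerate away from the origin in $\mathbb R^6$ (i.e. at every non-zero point at which the functions $u,v$ appearing in it are differentiable).
   Context: Let $x_0,\dots,x_7$ be the standard coordinates on $\mathbb R^8$, with partial derivatives $\partial_i$, and let $e=\sum_i dx_i\otimes dx_i$ and $R=\sum_i x_i^2$. Put $X=-x_1\partial_0+x_0\partial_1-x_3\partial_2+x_2\partial_3-x_5\partial_4+x_4\partial_5-x_7\partial_6+x_6\partial_7$, $Y_1=-x_1\partial_0+x_0\partial_1+x_3\partial_2-x_2\partial_3-x_5\partial_4+x_4\partial_5+x_7\partial_6-x_6\partial_7$, $Y_2=-x_2\partial_0+x_0\partial_2+x_1\partial_3-x_3\partial_1-x_6\partial_4+x_4\partial_6+x_5\partial_7-x_7\partial_5$, $Y_3=-x_3\partial_0+x_0\partial_3+x_2\partial_1-x_1\partial_2-x_7\partial_4+x_4\partial_7+x_6\partial_5-x_5\partial_6$, $\alpha_i=e(Y_i,\cdot)$ and $\hat\alpha_i=\alpha_i/R$. The flow of $Y_1$ is a free circle action on $\mathbb R^8\setminus0$ with quotient $\mathcal C=\mathbb R^+\times\mathbb{CP}^3$; tensors on $\mathcal C$ are identified with their pullbacks to $\mathbb R^8\setminus 0$.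 The conical $G_2$ structure on $\mathcal C$ has 3-form $\varphi=d(\tfrac13R^3\omega)$, where $\omega=d\hat\alpha_1+3\hat\alpha_2\wedge\hat\alpha_3$. The vector field $X$ generates a circle action on $\mathcal C$ preserving $\varphi$; its quotient is $Q:\mathcal C\to\mathcal M\cong\mathbb R^6\setminus0$, with coordinates $(\mathbf u,\mathbf v)=(u_1,u_2,u_3;v_1,v_2,v_3)$ given by $u_1=x_0^2+x_1^2-x_4^2-x_5^2$, $u_2=2(x_0x_4+x_1x_5)$, $u_3=2(x_0x_5-x_1x_4)$, $v_1=x_2^2+x_3^2-x_6^2-x_7^2$, $v_2=2(x_2x_6+x_3x_7)$, $v_3=2(x_2x_7-x_3x_6)$. Also $u=|\mathbf u|$, $v=|\mathbf v|$, $R=u+v$; the functions $u,v$ are not smooth in these coordinates across the loci $\mathbf u=\mathbf 0$, $\mathbf v=\mathbf0$. The closed 2-form $X\lrcorner\varphi$ descends to a 2-form $\sigma$ on $\mathcal M$. *)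

theory Defs
  imports "HOL-Analysis.Analysis"
begin

section \<open>Differential forms of low degree\<close>

text \<open>A form of degree k is a field of k-linear alternating functionals, written in curried form with
  the base point as first argument. The conventions are
  (a \<and> b)(v,w) = a(v) b(w) - a(w) b(v), and the Cartan formula without a factor 1/(k+1)
  for the exterior derivative; the Lie bracket terms of that formula are absent because the
  arguments v, w, z are constant vector fields.\<close>

type_synonym 'a form1 = "'a \<Rightarrow> 'a \<Rightarrow> real"
type_synonym 'a form2 = "'a \<Rightarrow> 'a \<Rightarrow> 'a \<Rightarrow> real"
type_synonym 'a form3 = "'a \<Rightarrow> 'a \<Rightarrow> 'a \<Rightarrow> 'a \<Rightarrow> real"

definition d0 :: "('a::real_normed_vector \<Rightarrow> real) \<Rightarrow> 'a form1" where
  "d0 f x v = frechet_derivative f (at x) v"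

definition d1 :: "'a::real_normed_vector form1 \<Rightarrow> 'a form2" where
  "d1 \<alpha> x v w = frechet_derivative (\<lambda>y. \<alpha> y w) (at x) v - frechet_derivative (\<lambda>y. \<alpha> y v) (at x) w"

definition d2 :: "'a::real_normed_vector form2 \<Rightarrow> 'a form3" where
  "d2 \<beta> x v w z = frechet_derivative (\<lambda>y. \<beta> y w z) (at x) v
     - frechet_derivative (\<lambda>y. \<beta> y v z) (at x) w
     + frechet_derivative (\<lambda>y. \<beta> y v w) (at x) z"

definition wedge :: "'a form1 \<Rightarrow> 'a form1 \<Rightarrow> 'a form2" where
  "wedge \<alpha> \<beta> x v w = \<alpha> x v * \<beta> x w - \<alpha> x w * \<beta> x v"

definition interior_prod :: "('a \<Rightarrow> 'a) \<Rightarrow> 'a form3 \<Rightarrow> 'a form2" where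
  "interior_prod Z \<phi> x v w = \<phi> x (Z x) v w"

definition pullback2 :: "('a::real_normed_vector \<Rightarrow> 'b::real_normed_vector) \<Rightarrow> 'b form2 \<Rightarrow> 'a form2" where
  "pullback2 F \<sigma> x v w =
     \<sigma> (F x) (frechet_derivative F (at x) v) (frechet_derivative F (at x) w)"

definition alternating2 :: "('a::real_vector \<Rightarrow> 'a \<Rightarrow> real) \<Rightarrow> bool" where
  "alternating2 s \<longleftrightarrow> bilinear s \<and> (\<forall>v. s v v = 0)"

definition nondegenerate2 :: "('a::real_vector \<Rightarrow> 'a \<Rightarrow> real) \<Rightarrow> bool" where
  "nondegenerate2 s \<longleftrightarrow> (\<forall>v. (\<forall>w. s v w = 0) \<longrightarrow> v = 0)"

text \<open>The 2-form \<open>\<sigma>\<close> on \<open>S\<close> is the descent of \<open>\<beta>\<close> along \<open>F\<close>.\<close>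

definition descends_to :: "'b::real_normed_vector set \<Rightarrow> ('a::real_normed_vector \<Rightarrow> 'b)
    \<Rightarrow> 'a form2 \<Rightarrow> 'b form2 \<Rightarrow> bool" where
  "descends_to S F \<beta> \<sigma> \<longleftrightarrow>
     (\<forall>m\<in>S. alternating2 (\<sigma> m)) \<and>
     (\<forall>x. F x \<in> S \<longrightarrow> (\<forall>v w. pullback2 F \<sigma> x v w = \<beta> x v w))"

section \<open>Vector fields and forms on \<open>\<real>\<^sup>8\<close>\<close>

text \<open>Coordinates are indexed by the numeral type \<open>8\<close>, with elements 0, ..., 7.\<close>

type_synonym R8 = "real ^ 8"

definition pd :: "8 \<Rightarrow> R8" where
  "pd i = axis i 1"

definition X :: "R8 \<Rightarrow> R8" where
  "X x = - (x$1) *\<^sub>R pd 0 + (x$0) *\<^sub>R pd 1 - (x$3) *\<^sub>R pd 2 + (x$2) *\<^sub>R pd 3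
         - (x$5) *\<^sub>R pd 4 + (x$4) *\<^sub>R pd 5 - (x$7) *\<^sub>R pd 6 + (x$6) *\<^sub>R pd 7"

definition Y1 :: "R8 \<Rightarrow> R8" where
  "Y1 x = - (x$1) *\<^sub>R pd 0 + (x$0) *\<^sub>R pd 1 + (x$3) *\<^sub>R pd 2 - (x$2) *\<^sub>R pd 3
          - (x$5) *\<^sub>R pd 4 + (x$4) *\<^sub>R pd 5 + (x$7) *\<^sub>R pd 6 - (x$6) *\<^sub>R pd 7"

definition Y2 :: "R8 \<Rightarrow> R8" where
  "Y2 x = - (x$2) *\<^sub>R pd 0 + (x$0) *\<^sub>R pd 2 + (x$1) *\<^sub>R pd 3 - (x$3) *\<^sub>R pd 1
          - (x$6) *\<^sub>R pd 4 + (x$4) *\<^sub>R pd 6 + (x$5) *\<^sub>R pd 7 - (x$7) *\<^sub>R pd 5"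

definition Y3 :: "R8 \<Rightarrow> R8" where
  "Y3 x = - (x$3) *\<^sub>R pd 0 + (x$0) *\<^sub>R pd 3 + (x$2) *\<^sub>R pd 1 - (x$1) *\<^sub>R pd 2
          - (x$7) *\<^sub>R pd 4 + (x$4) *\<^sub>R pd 7 + (x$6) *\<^sub>R pd 5 - (x$5) *\<^sub>R pd 6"

definition R :: "R8 \<Rightarrow> real" where
  "R x = (\<Sum>i\<in>UNIV. (x$i)\<^sup>2)"

text \<open>The Euclidean metric \<open>e\<close> is the inner product.\<close>

definition flat :: "(R8 \<Rightarrow> R8) \<Rightarrow> R8 form1" where
  "flat Y x v = Y x \<bullet> v"

definition hat_flat :: "(R8 \<Rightarrow> R8) \<Rightarrow> R8 form1" where
  "hat_flat Y x v = flat Y x v / R x"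

definition omega :: "R8 form2" where
  "omega x v w = d1 (hat_flat Y1) x v w + 3 * wedge (hat_flat Y2) (hat_flat Y3) x v w"

text \<open>The forms below live on the cone \<open>\<C> = (\<real>\<^sup>8 - {0}) / Y1\<close> and are identified with their
  pullbacks to \<open>\<real>\<^sup>8 - {0}\<close>.\<close>

definition phi :: "R8 form3" where
  "phi = d2 (\<lambda>x v w. (1/3) * R x ^ 3 * omega x v w)"

section \<open>The quotient and its coordinates\<close>

text \<open>\<open>\<real>\<^sup>6\<close> is the space of pairs \<open>(u,v)\<close>. In the index type \<open>3\<close> the element 3 equals 0.\<close>

type_synonym R6 = "(real ^ 3) \<times> (real ^ 3)"

definition Q :: "R8 \<Rightarrow> R6" where
  "Q x =
    (vector [(x$0)\<^sup>2 + (x$1)\<^sup>2 - (x$4)\<^sup>2 - (x$5)\<^sup>2,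
             2 * (x$0 * x$4 + x$1 * x$5),
             2 * (x$0 * x$5 - x$1 * x$4)],
     vector [(x$2)\<^sup>2 + (x$3)\<^sup>2 - (x$6)\<^sup>2 - (x$7)\<^sup>2,
             2 * (x$2 * x$6 + x$3 * x$7),
             2 * (x$2 * x$7 - x$3 * x$6)])"

definition unorm :: "R6 \<Rightarrow> real" where
  "unorm m = norm (fst m)"

definition vnorm :: "R6 \<Rightarrow> real" where
  "vnorm m = norm (snd m)"

definition p :: "R6 \<Rightarrow> real ^ 3" where
  "p m = fst m + snd m"

definition q :: "R6 \<Rightarrow> real ^ 3" where
  "q m = (unorm m + vnorm m) *\<^sub>R (fst m - snd m)"

text \<open>The points of \<open>\<M> = \<real>\<^sup>6 - {0}\<close> at which the coordinate expression of \<open>\<sigma>\<close> makes sense.\<close>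

definition M_reg :: "R6 set" where
  "M_reg = {m. m \<noteq> 0 \<and> unorm differentiable (at m) \<and> vnorm differentiable (at m)}"

end

theory Submission
  imports Defs
begin

text \<open>\<open>R\<^sup>3 \<omega> / 3\<close> is polynomial in the coordinates, hence so is \<open>\<phi>\<close>. Contracting with \<open>X\<close> reduces the
  formula for \<open>\<sigma>\<close> to two identities relating \<open>Y2\<close>, \<open>Y3\<close> to the differential of \<open>Q\<close>, in which the terms
  \<open>du \<and> dv\<close> cancel. The map \<open>Q\<close> is a product of two Hopf maps \<open>\<real>\<^sup>4 \<rightarrow> \<real>\<^sup>3\<close>, hence surjective, and a
  submersion where \<open>u\<close> and \<open>v\<close> do not vanish; so the form descends in at most one way. Finally
  \<open>\<Sum> dp\<^sub>i \<and> dq\<^sub>i\<close> is non-degenerate as soon as \<open>(dp, dq)\<close> is injective: on the kernel of \<open>dp\<close>, \<open>dq\<close> is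
  \<open>2 R\<close> times the identity plus the rank-one map \<open>a \<mapsto> \<langle>a, n\<rangle> w\<close> with \<open>w = \<^bold>u - \<^bold>v\<close>,
  \<open>n = \<^bold>u/u - \<^bold>v/v\<close> and \<open>\<langle>w, n\<rangle> \<ge> 0\<close>.\<close>

section \<open>The 3-form\<close>

lemma UNIV_8: "(UNIV :: 8 set) = {0, 1, 2, 3, 4, 5, 6, 7}"
proof -
  have "card {0, 1, 2, 3, 4, 5, 6, 7 :: 8} = 8"
    by simp
  then show ?thesis
    by (intro card_subset_eq [symmetric]) auto
qed

lemma sum_8: "sum f (UNIV :: 8 set) = f 0 + f 1 + f 2 + f 3 + f 4 + f 5 + f 6 + (f 7 :: real)"
  unfolding UNIV_8 by (simp add: ac_simps)

lemma inner_8: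
  fixes x y :: R8
  shows "x \<bullet> y = x$0 * y$0 + x$1 * y$1 + x$2 * y$2 + x$3 * y$3
    + x$4 * y$4 + x$5 * y$5 + x$6 * y$6 + x$7 * y$7"
  by (simp add: inner_vec_def sum_8)

lemma X_nth [simp]:
  "X x $ 0 = - x$1" "X x $ 1 = x$0" "X x $ 2 = - x$3" "X x $ 3 = x$2"
  "X x $ 4 = - x$5" "X x $ 5 = x$4" "X x $ 6 = - x$7" "X x $ 7 = x$6"
  by (simp_all add: X_def pd_def axis_def)

lemma Y1_nth [simp]:
  "Y1 x $ 0 = - x$1" "Y1 x $ 1 = x$0" "Y1 x $ 2 = x$3" "Y1 x $ 3 = - x$2"
  "Y1 x $ 4 = - x$5" "Y1 x $ 5 = x$4" "Y1 x $ 6 = x$7" "Y1 x $ 7 = - x$6"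
  by (simp_all add: Y1_def pd_def axis_def)

lemma Y2_nth [simp]:
  "Y2 x $ 0 = - x$2" "Y2 x $ 1 = - x$3" "Y2 x $ 2 = x$0" "Y2 x $ 3 = x$1"
  "Y2 x $ 4 = - x$6" "Y2 x $ 5 = - x$7" "Y2 x $ 6 = x$4" "Y2 x $ 7 = x$5"
  by (simp_all add: Y2_def pd_def axis_def)

lemma Y3_nth [simp]:
  "Y3 x $ 0 = - x$3" "Y3 x $ 1 = x$2" "Y3 x $ 2 = - x$1" "Y3 x $ 3 = x$0"
  "Y3 x $ 4 = - x$7" "Y3 x $ 5 = x$6" "Y3 x $ 6 = - x$5" "Y3 x $ 7 = x$4"
  by (simp_all add: Y3_def pd_def axis_def)

lemma linear_Y: "linear Y1" "linear Y2" "linear Y3"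
  by (auto intro!: linearI simp: Y1_def Y2_def Y3_def algebra_simps)

lemma R_inner: "R x = x \<bullet> x"
  by (simp add: R_def inner_8 sum_8 power2_eq_square)

lemma R_pos: "x \<noteq> 0 \<Longrightarrow> R x > 0"
  by (simp add: R_inner)

section \<open>Derivatives of the radius function and of the rescaled 1-forms\<close>

lemma has_derivative_R [derivative_intros]:
  "(R has_derivative (\<lambda>h. 2 * (x \<bullet> h))) (at x)"
  unfolding R_inner [abs_def] by (auto intro!: derivative_eq_intros simp: inner_commute)

lemma has_derivative_flat:
  assumes "linear Y"
  shows "((\<lambda>y. flat Y y b) has_derivative (\<lambda>h. flat Y h b)) (at x)"
  unfolding flat_def
  by (rule has_derivative_inner_left, rule linear_imp_has_derivative, rule assms)

lemma has_derivative_hat_flat: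
  assumes "linear Y" "x \<noteq> 0"
  shows "((\<lambda>y. hat_flat Y y b) has_derivative
    (\<lambda>h. flat Y h b / R x - 2 * (x \<bullet> h) * flat Y x b / (R x)\<^sup>2)) (at x)"
proof -
  have "R x \<noteq> 0"
    using R_pos[OF assms(2)] by simp
  show ?thesis
    unfolding hat_flat_def
    by (rule has_derivative_eq_rhs
        [OF has_derivative_divide'[OF has_derivative_flat[OF assms(1)] has_derivative_R \<open>R x \<noteq> 0\<close>]])
       (use \<open>R x \<noteq> 0\<close> in \<open>simp add: fun_eq_iff field_simps power2_eq_square\<close>)
qed

lemma d1_hat_flat:
  assumes "linear Y" "x \<noteq> 0"
  shows "d1 (hat_flat Y) x a b =
    (flat Y a b - flat Y b a) / R x - 2 * ((x \<bullet> a) * flat Y x b - (x \<bullet> b) * flat Y x a) / (R x)\<^sup>2"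
  unfolding d1_def frechet_derivative_at[OF has_derivative_hat_flat[OF assms], symmetric]
  by (simp add: algebra_simps diff_divide_distrib)

text \<open>The matrices of the three fields are skew, so the exterior derivative of
  \<open>flat Y\<close> is twice the constant form \<open>flat Y a b\<close>.\<close>

lemma skew_flat: "flat Y1 a b = - flat Y1 b a" "flat Y2 a b = - flat Y2 b a" "flat Y3 a b = - flat Y3 b a"
  by (simp_all add: flat_def inner_8)

text \<open>The factor \<open>R x ^ 3\<close> clears the denominators of \<open>omega\<close>. At
  the origin every term carries a factor \<open>R x = 0\<close>, so the identity holds at all points
  and can be used under the binder when differentiating.\<close>

lemma R3_omega:
  "(1/3) * R x ^ 3 * omega x a b =
     (2/3) * (R x)\<^sup>2 * flat Y1 a b - (2/3) * R x * ((x \<bullet> a) * flat Y1 x b - (x \<bullet> b) * flat Y1 x a)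
     + R x * wedge (flat Y2) (flat Y3) x a b"
proof (cases "x = 0")
  case True
  then show ?thesis by (simp add: R_inner)
next
  case False
  have r: "R x \<noteq> 0" using R_pos[OF False] by simp
  have s: "flat Y1 b a = - flat Y1 a b" by (rule skew_flat)
  have "(1/3) * r ^ 3 * ((A - - A) / r - 2 * B / r\<^sup>2 + 3 * (c / r * (d / r) - e / r * (f / r)))
    = (2/3) * r\<^sup>2 * A - (2/3) * r * B + r * (c * d - e * f)" if "r \<noteq> 0" for r A B c d e f :: real
    using that by (simp add: divide_simps) algebra
  from this[OF r] show ?thesis
    unfolding omega_def d1_hat_flat[OF linear_Y(1) False] wedge_def hat_flat_def s .
qed

lemma has_derivative_wedge_flat:
  assumes "linear Y" "linear Z"
  shows "((\<lambda>y. wedge (flat Y) (flat Z) y a b) has_derivative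
    (\<lambda>h. flat Y h a * flat Z x b + flat Y x a * flat Z h b
       - flat Y h b * flat Z x a - flat Y x b * flat Z h a)) (at x)"
  unfolding wedge_def
  by (rule has_derivative_eq_rhs, (rule derivative_eq_intros has_derivative_flat assms refl)+)
     (simp add: fun_eq_iff)

lemma frechet_R3_omega:
  "frechet_derivative (\<lambda>y. (1/3) * R y ^ 3 * omega y a b) (at x) h =
     (8/3) * R x * (x \<bullet> h) * flat Y1 a b
      - (4/3) * (x \<bullet> h) * ((x \<bullet> a) * flat Y1 x b - (x \<bullet> b) * flat Y1 x a)
      - (2/3) * R x * ((h \<bullet> a) * flat Y1 x b + (x \<bullet> a) * flat Y1 h b
          - (h \<bullet> b) * flat Y1 x a - (x \<bullet> b) * flat Y1 h a)
      + 2 * (x \<bullet> h) * wedge (flat Y2) (flat Y3) x a b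
      + R x * (flat Y2 h a * flat Y3 x b + flat Y2 x a * flat Y3 h b
          - flat Y2 h b * flat Y3 x a - flat Y2 x b * flat Y3 h a)" (is "_ = ?D h")
proof -
  have "((\<lambda>y. (1/3) * R y ^ 3 * omega y a b) has_derivative ?D) (at x)"
    unfolding R3_omega power2_eq_square
    by (rule has_derivative_eq_rhs,
        (rule has_derivative_add has_derivative_diff has_derivative_mult has_derivative_const
          has_derivative_R has_derivative_inner_left has_derivative_ident
          has_derivative_flat has_derivative_wedge_flat linear_Y)+,
        rule ext, algebra)
  from frechet_derivative_at[OF this] show ?thesis
    by (rule fun_cong[OF sym])
qed

text \<open>Leibniz rule on the polynomial form: the second line is dR wedge
  \<open>wedge (flat Y2) (flat Y3)\<close>, the third is \<open>R x\<close> times the exterior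
  derivative of that wedge. In the first line the coefficient 4 is 8/3 + 4/3, from the two
  \<open>flat Y1\<close> terms of \<open>R3_omega\<close>.\<close>

lemma phi_eq:
  "phi x a b c =
     4 * R x * ((x \<bullet> a) * flat Y1 b c + (x \<bullet> b) * flat Y1 c a + (x \<bullet> c) * flat Y1 a b)
     + 2 * ((x \<bullet> a) * wedge (flat Y2) (flat Y3) x b c + (x \<bullet> b) * wedge (flat Y2) (flat Y3) x c a
            + (x \<bullet> c) * wedge (flat Y2) (flat Y3) x a b)
     + 2 * R x * (flat Y2 a b * flat Y3 x c + flat Y2 b c * flat Y3 x a + flat Y2 c a * flat Y3 x b
            - flat Y3 a b * flat Y2 x c - flat Y3 b c * flat Y2 x a - flat Y3 c a * flat Y2 x b)"
proof -
  have s: "flat Y1 b a = - flat Y1 a b" "flat Y1 c b = - flat Y1 b c" "flat Y1 c a = - flat Y1 a c"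
    "flat Y2 b a = - flat Y2 a b" "flat Y2 c b = - flat Y2 b c" "flat Y2 c a = - flat Y2 a c"
    "flat Y3 b a = - flat Y3 a b" "flat Y3 c b = - flat Y3 b c" "flat Y3 c a = - flat Y3 a c"
    by (rule skew_flat)+
  show ?thesis
    unfolding phi_def d2_def frechet_R3_omega wedge_def
    unfolding s inner_commute[of b a] inner_commute[of c a] inner_commute[of c b]
    by algebra
qed

section \<open>Pullback of the coordinates p and q\<close>

lemma has_derivative_vector_3:
  fixes f g h :: "'a::real_normed_vector \<Rightarrow> real"
  assumes "(f has_derivative f') (at x)" "(g has_derivative g') (at x)" "(h has_derivative h') (at x)"
  shows "((\<lambda>y. vector [f y, g y, h y] :: real^3) has_derivative (\<lambda>y. vector [f' y, g' y, h' y])) (at x)"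
proof -
  have *: "vector [a, b, c] = a *\<^sub>R axis 1 1 + b *\<^sub>R axis 2 1 + c *\<^sub>R (axis 3 1 :: real^3)" for a b c :: real
    by (simp add: vec_eq_iff forall_3 axis_def)
  show ?thesis
    unfolding * by (intro has_derivative_add has_derivative_scaleR_left assms)
qed

definition dQ_map :: "R8 \<Rightarrow> R8 \<Rightarrow> R6" where
  "dQ_map x h =
    (vector [2 * (x$0 * h$0 + x$1 * h$1 - x$4 * h$4 - x$5 * h$5),
             2 * (x$0 * h$4 + x$4 * h$0 + x$1 * h$5 + x$5 * h$1),
             2 * (x$0 * h$5 + x$5 * h$0 - x$1 * h$4 - x$4 * h$1)],
     vector [2 * (x$2 * h$2 + x$3 * h$3 - x$6 * h$6 - x$7 * h$7),
             2 * (x$2 * h$6 + x$6 * h$2 + x$3 * h$7 + x$7 * h$3),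
             2 * (x$2 * h$7 + x$7 * h$2 - x$3 * h$6 - x$6 * h$3)])"

lemma has_derivative_Q: "(Q has_derivative dQ_map x) (at x)"
proof -
  have n: "((\<lambda>y. y $ i) has_derivative (\<lambda>h. h $ i)) (at x)" for i :: 8
    by (rule bounded_linear_imp_has_derivative) (rule bounded_linear_vec_nth)
  show ?thesis
    unfolding Q_def [abs_def] dQ_map_def [abs_def] power2_eq_square
    by (intro has_derivative_Pair has_derivative_vector_3;
        rule has_derivative_eq_rhs, (rule has_derivative_add has_derivative_diff has_derivative_mult
          has_derivative_const n)+, simp add: fun_eq_iff algebra_simps)
qed

lemma norm_vec_3: "norm (v :: real^3) = sqrt ((v$1)\<^sup>2 + (v$2)\<^sup>2 + (v$3)\<^sup>2)"
  by (simp add: norm_vec_def L2_set_def sum_3)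

text \<open>With z = x0 + i x1 and w = x4 + i x5, the first component of \<open>Q\<close> is the
  Hopf map (|z|^2 - |w|^2, 2 conj(z) w), whose norm is |z|^2 + |w|^2.\<close>

lemma unorm_Q: "unorm (Q x) = (x$0)\<^sup>2 + (x$1)\<^sup>2 + (x$4)\<^sup>2 + (x$5)\<^sup>2"
  unfolding unorm_def norm_vec_3
  by (rule real_sqrt_unique) (simp_all add: Q_def, algebra)

lemma vnorm_Q: "vnorm (Q x) = (x$2)\<^sup>2 + (x$3)\<^sup>2 + (x$6)\<^sup>2 + (x$7)\<^sup>2"
  unfolding vnorm_def norm_vec_3
  by (rule real_sqrt_unique) (simp_all add: Q_def, algebra)

lemma R_eq_norm_Q: "R x = unorm (Q x) + vnorm (Q x)"
  by (simp add: unorm_Q vnorm_Q R_def sum_8)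

lemma d0_eqI: "(f has_derivative f') (at x) \<Longrightarrow> d0 f x = f'"
  by (simp add: d0_def fun_eq_iff frechet_derivative_at [symmetric])

lemma d0_p_Q: "d0 (\<lambda>y. p (Q y) $ i) x h = (fst (dQ_map x h) + snd (dQ_map x h)) $ i"
proof -
  have "((\<lambda>y. p (Q y) $ i) has_derivative (\<lambda>h. (fst (dQ_map x h) + snd (dQ_map x h)) $ i)) (at x)"
    unfolding p_def
    by (intro bounded_linear.has_derivative[OF bounded_linear_vec_nth] has_derivative_add
        has_derivative_fst has_derivative_snd has_derivative_Q)
  from d0_eqI[OF this] show ?thesis
    by simp
qed

text \<open>Along \<open>Q\<close> the factor u + v of \<open>q\<close> becomes the polynomial
  \<open>R\<close>, so the composite is differentiable even where u or v is not.\<close>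

lemma d0_q_Q: "d0 (\<lambda>y. q (Q y) $ i) x h =
  2 * (x \<bullet> h) * (fst (Q x) - snd (Q x)) $ i + R x * (fst (dQ_map x h) - snd (dQ_map x h)) $ i"
proof -
  have "((\<lambda>y. q (Q y) $ i) has_derivative
      (\<lambda>h. (R x *\<^sub>R (fst (dQ_map x h) - snd (dQ_map x h)) + (2 * (x \<bullet> h)) *\<^sub>R (fst (Q x) - snd (Q x))) $ i)) (at x)"
    unfolding q_def R_eq_norm_Q [symmetric]
    by (intro bounded_linear.has_derivative[OF bounded_linear_vec_nth] has_derivative_scaleR
        has_derivative_R has_derivative_diff has_derivative_fst has_derivative_snd has_derivative_Q)
  from d0_eqI[OF this] show ?thesis
    by simp
qed

section \<open>Contraction of the 3-form with the circle generator\<close>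

text \<open>The differentials of \<open>unorm \<circ> Q\<close> and \<open>vnorm \<circ> Q\<close>.\<close>

definition dU :: "R8 \<Rightarrow> R8 \<Rightarrow> real" where
  "dU x h = 2 * (x$0 * h$0 + x$1 * h$1 + x$4 * h$4 + x$5 * h$5)"

definition dV :: "R8 \<Rightarrow> R8 \<Rightarrow> real" where
  "dV x h = 2 * (x$2 * h$2 + x$3 * h$3 + x$6 * h$6 + x$7 * h$7)"

text \<open>The composite of \<open>Y1\<close> and \<open>X\<close> is -1 on coordinates 0, 1, 4, 5
  and +1 on 2, 3, 6, 7.\<close>

lemma flat_Y1_X: "2 * flat Y1 (X x) h = dV x h - dU x h"
  by (simp add: flat_def inner_8 dU_def dV_def)

lemma inner_X_self: "x \<bullet> X x = 0"
  by (simp add: inner_8)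

lemma dR_eq: "2 * (x \<bullet> h) = dU x h + dV x h"
  by (simp add: inner_8 dU_def dV_def)

text \<open>The left side is the contraction of \<open>wedge (flat Y2) (flat Y3)\<close> with
  \<open>X\<close>.\<close>

lemma X_flat_Y23:
  "flat Y2 x (X x) * flat Y3 x h - flat Y2 x h * flat Y3 x (X x) =
    (1/2) * (R x * (dU x h - dV x h) - (fst (Q x) - snd (Q x)) \<bullet> (fst (dQ_map x h) + snd (dQ_map x h)))"
  by (simp add: flat_def inner_8 R_inner dU_def dV_def Q_def dQ_map_def inner_vec_def sum_3) algebra

text \<open>The left side is the contraction with \<open>X\<close> of the exterior derivative of
  \<open>wedge (flat Y2) (flat Y3)\<close>.\<close>

lemma X_d_wedge_Y23:
  "2 * (flat Y2 (X x) a * flat Y3 x b + flat Y2 a b * flat Y3 x (X x) - flat Y2 (X x) b * flat Y3 x a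
     - flat Y3 (X x) a * flat Y2 x b - flat Y3 a b * flat Y2 x (X x) + flat Y3 (X x) b * flat Y2 x a) =
   fst (dQ_map x a) \<bullet> snd (dQ_map x b) - fst (dQ_map x b) \<bullet> snd (dQ_map x a) + (dU x a * dV x b - dU x b * dV x a)"
  by (simp add: flat_def inner_8 dU_def dV_def dQ_map_def inner_vec_def sum_3) algebra

lemma interior_prod_X_phi:
  "interior_prod X phi x v w =
      - (1/2) * (\<Sum>i\<in>UNIV. wedge (d0 (\<lambda>y. p (Q y) $ i)) (d0 (\<lambda>y. q (Q y) $ i)) x v w)"
proof -
  let ?g = "\<lambda>h. flat Y2 x (X x) * flat Y3 x h - flat Y2 x h * flat Y3 x (X x)"
  let ?G = "\<lambda>h. (fst (Q x) - snd (Q x)) \<bullet> (fst (dQ_map x h) + snd (dQ_map x h))"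
  let ?uv = "fst (dQ_map x v) \<bullet> snd (dQ_map x w) - fst (dQ_map x w) \<bullet> snd (dQ_map x v)"
  have s: "flat Y1 w (X x) = - flat Y1 (X x) w" "flat Y2 w (X x) = - flat Y2 (X x) w"
    "flat Y3 w (X x) = - flat Y3 (X x) w"
    by (rule skew_flat)+
  have "interior_prod X phi x v w =
      R x * ((2 * (x \<bullet> w)) * (2 * flat Y1 (X x) v) - (2 * (x \<bullet> v)) * (2 * flat Y1 (X x) w))
      + (2 * (x \<bullet> w)) * ?g v - (2 * (x \<bullet> v)) * ?g w
      + R x * (2 * (flat Y2 (X x) v * flat Y3 x w + flat Y2 v w * flat Y3 x (X x) - flat Y2 (X x) w * flat Y3 x v
     - flat Y3 (X x) v * flat Y2 x w - flat Y3 v w * flat Y2 x (X x) + flat Y3 (X x) w * flat Y2 x v))"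
    unfolding interior_prod_def phi_eq wedge_def inner_X_self s by algebra
  \<comment> \<open>The three summands contribute du wedge dv with coefficients -2R, R and R, which
    cancel.\<close>
  also have "\<dots> = R x * ?uv + (1/2) * ((2 * (x \<bullet> v)) * ?G w - (2 * (x \<bullet> w)) * ?G v)"
    unfolding X_d_wedge_Y23 X_flat_Y23 flat_Y1_X dR_eq by algebra
  \<comment> \<open>In (du_i + dv_i) wedge (du_i - dv_i), summed over i, only -2 du_i wedge dv_i
    survives; this gives the term \<open>?uv\<close>.\<close>
  also have "\<dots> = - (1/2) * (\<Sum>i\<in>UNIV. wedge (d0 (\<lambda>y. p (Q y) $ i)) (d0 (\<lambda>y. q (Q y) $ i)) x v w)"
    unfolding wedge_def d0_p_Q d0_q_Q inner_vec_def sum_3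
    by (simp only: inner_real_def vector_add_component vector_minus_component) algebra
  finally show ?thesis .
qed

section \<open>The 2-form on the quotient\<close>

lemma not_differentiable_norm_0: "\<not> (norm :: 'a::{real_inner, perfect_space} \<Rightarrow> real) differentiable (at 0)"
proof
  assume "(norm :: 'a \<Rightarrow> real) differentiable (at 0)"
  then obtain L where L: "(norm has_derivative L) (at (0 :: 'a))"
    by (auto simp: differentiable_def)
  \<comment> \<open>The origin minimises the norm, so a derivative there would vanish, whereas the
    quotient \<open>norm h / norm h\<close> tends to 1.\<close>
  have "L = (\<lambda>_. 0)"
    by (rule differential_zero_maxmin[OF _ open_UNIV L]) auto
  with L have "((\<lambda>h::'a. norm h / norm h) \<longlongrightarrow> 0) (at 0)"
    by (simp add: has_derivative_at)
  moreover have "((\<lambda>h::'a. norm h / norm h) \<longlongrightarrow> 1) (at 0)"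
    by (rule tendsto_eventually) (simp add: eventually_at_filter)
  ultimately show False
    using tendsto_unique[OF trivial_limit_at] by force
qed

lemma has_derivative_unorm:
  "fst m \<noteq> 0 \<Longrightarrow> (unorm has_derivative (\<lambda>h. fst h \<bullet> sgn (fst m))) (at m)"
  unfolding unorm_def [abs_def]
  by (rule has_derivative_compose[OF has_derivative_fst[OF has_derivative_ident] has_derivative_norm])

lemma has_derivative_vnorm:
  "snd m \<noteq> 0 \<Longrightarrow> (vnorm has_derivative (\<lambda>h. snd h \<bullet> sgn (snd m))) (at m)"
  unfolding vnorm_def [abs_def]
  by (rule has_derivative_compose[OF has_derivative_snd[OF has_derivative_ident] has_derivative_norm])

text \<open>On the slice through \<open>m\<close> parallel to one factor, \<open>unorm\<close> or
  \<open>vnorm\<close> is the plain norm, which is not differentiable at 0.\<close>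

lemma M_reg_iff: "m \<in> M_reg \<longleftrightarrow> fst m \<noteq> 0 \<and> snd m \<noteq> 0"
proof
  assume "m \<in> M_reg"
  then have d: "unorm differentiable (at m)" "vnorm differentiable (at m)"
    by (auto simp: M_reg_def)
  have 1: "(\<lambda>z. (z, snd m)) differentiable (at (fst m))"
    unfolding differentiable_def
    by (rule exI, rule has_derivative_Pair[OF has_derivative_ident has_derivative_const])
  have 2: "(\<lambda>z. (fst m, z)) differentiable (at (snd m))"
    unfolding differentiable_def
    by (rule exI, rule has_derivative_Pair[OF has_derivative_const has_derivative_ident])
  have "(unorm \<circ> (\<lambda>z. (z, snd m))) differentiable (at (fst m))"
    "(vnorm \<circ> (\<lambda>z. (fst m, z))) differentiable (at (snd m))"
    using d by (intro differentiable_chain_at 1 2; simp)+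
  then have "norm differentiable (at (fst m))" "norm differentiable (at (snd m))"
    by (simp_all add: o_def unorm_def vnorm_def)
  then show "fst m \<noteq> 0 \<and> snd m \<noteq> 0"
    using not_differentiable_norm_0 by metis
next
  assume *: "fst m \<noteq> 0 \<and> snd m \<noteq> 0"
  have "unorm differentiable (at m)" "vnorm differentiable (at m)"
    using * has_derivative_unorm has_derivative_vnorm differentiableI by blast+
  with * show "m \<in> M_reg"
    by (auto simp: M_reg_def)
qed

text \<open>\<open>sgn\<close> is the gradient of the norm away from 0. Since
  \<open>sgn 0 = 0\<close>, the formula stays linear in \<open>a\<close> outside
  \<open>M_reg\<close> as well.\<close>

definition dq_map :: "R6 \<Rightarrow> R6 \<Rightarrow> real^3" where
  "dq_map m a = (unorm m + vnorm m) *\<^sub>R (fst a - snd a)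
     + (fst a \<bullet> sgn (fst m) + snd a \<bullet> sgn (snd m)) *\<^sub>R (fst m - snd m)"

lemma has_derivative_p: "(p has_derivative p) (at m)"
  unfolding p_def [abs_def]
  by (intro has_derivative_add has_derivative_fst has_derivative_snd has_derivative_ident)

lemma has_derivative_q:
  assumes "m \<in> M_reg"
  shows "(q has_derivative dq_map m) (at m)"
proof -
  have "fst m \<noteq> 0" "snd m \<noteq> 0"
    using assms by (auto simp: M_reg_iff)
  then show ?thesis
    unfolding q_def [abs_def] dq_map_def [abs_def]
    by (intro has_derivative_scaleR has_derivative_add has_derivative_diff
      has_derivative_unorm has_derivative_vnorm
      has_derivative_fst has_derivative_snd has_derivative_ident)
qed

definition sigma :: "R6 form2" where
  "sigma m a b = - (1/2) * (p a \<bullet> dq_map m b - p b \<bullet> dq_map m a)"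

lemma sigma_eq:
  assumes "m \<in> M_reg"
  shows "- (1/2) * (\<Sum>i\<in>UNIV. wedge (d0 (\<lambda>n. p n $ i)) (d0 (\<lambda>n. q n $ i)) m a b) = sigma m a b"
proof -
  note bounded_linear.has_derivative[OF bounded_linear_vec_nth]
  note * = this[OF has_derivative_p, THEN d0_eqI] this[OF has_derivative_q[OF assms], THEN d0_eqI]
  show ?thesis
    unfolding sigma_def wedge_def * by (simp add: inner_vec_def sum_subtractf)
qed

lemma pullback_sigma:
  assumes "Q x \<in> M_reg"
  shows "pullback2 Q sigma x v w =
    - (1/2) * (\<Sum>i\<in>UNIV. wedge (d0 (\<lambda>y. p (Q y) $ i)) (d0 (\<lambda>y. q (Q y) $ i)) x v w)"
proof -
  note c = has_derivative_compose[OF has_derivative_Q]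
  note bounded_linear.has_derivative[OF bounded_linear_vec_nth]
  note * = this[OF c[OF has_derivative_p], THEN d0_eqI] this[OF c[OF has_derivative_q[OF assms]], THEN d0_eqI]
  show ?thesis
    unfolding sigma_def wedge_def * pullback2_def frechet_derivative_at[OF has_derivative_Q, symmetric]
    by (simp add: inner_vec_def sum_subtractf)
qed

lemma linear_p: "linear p"
  using has_derivative_linear[OF has_derivative_p] .

lemma linear_dq_map: "linear (dq_map m)"
  by (rule linearI) (simp_all add: dq_map_def algebra_simps inner_add_left)

lemma alternating_sigma: "alternating2 (sigma m)"
proof -
  have "linear (\<lambda>b. sigma m a b)" "linear (\<lambda>b. sigma m b a)" for a
    unfolding sigma_def
    by (rule linearI; simp add: linear_add[OF linear_p] linear_add[OF linear_dq_map]
        linear_scale[OF linear_p] linear_scale[OF linear_dq_map] inner_add_left inner_add_right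
        right_diff_distrib add_divide_distrib)+
  then show ?thesis
    by (simp add: alternating2_def bilinear_def) (simp add: sigma_def)
qed

section \<open>Non-degeneracy\<close>

lemma inner_sgn_self: "x \<bullet> sgn x = norm (x :: 'a::real_inner)"
  by (cases "x = 0") (simp_all add: sgn_div_norm dot_square_norm power2_eq_square)

lemma inj_p_dq_map:
  assumes m: "m \<in> M_reg" and "p a = 0" "dq_map m a = 0"
  shows "a = 0"
proof -
  let ?u = "fst m" and ?v = "snd m" and ?R = "unorm m + vnorm m"
  let ?w = "?u - ?v" and ?n = "sgn ?u - sgn ?v"
  have nz: "?u \<noteq> 0" "?v \<noteq> 0"
    using m by (auto simp: M_reg_iff)
  have a2: "snd a = - fst a"
    using \<open>p a = 0\<close> by (simp add: p_def add_eq_0_iff)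
  have R: "?R > 0"
    using nz by (simp add: unorm_def vnorm_def add_pos_pos)
  have 1: "fst a - snd a = 2 *\<^sub>R fst a"
    by (simp add: a2 vec_eq_iff)
  have 2: "fst a \<bullet> sgn ?u + snd a \<bullet> sgn ?v = fst a \<bullet> ?n"
    by (simp add: a2 inner_diff_right)
  have eq: "(2 * ?R) *\<^sub>R fst a + (fst a \<bullet> ?n) *\<^sub>R ?w = 0"
    using \<open>dq_map m a = 0\<close> unfolding dq_map_def 1 2 by (simp only: scaleR_scaleR mult.commute)
  \<comment> \<open>Cauchy-Schwarz against unit vectors bounds the cross terms of
    \<open>?w \<bullet> ?n\<close> by the diagonal ones.\<close>
  have "?u \<bullet> sgn ?v \<le> norm ?u" "?v \<bullet> sgn ?u \<le> norm ?v"
    using norm_cauchy_schwarz[of ?u "sgn ?v"] norm_cauchy_schwarz[of ?v "sgn ?u"] nz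
    by (simp_all add: norm_sgn)
  then have "?w \<bullet> ?n \<ge> 0"
    by (simp add: inner_diff_left inner_diff_right inner_sgn_self)
  \<comment> \<open>Pairing \<open>eq\<close> with \<open>?n\<close> isolates the scalar
    \<open>fst a \<bullet> ?n\<close>; its cofactor is at least \<open>2 * ?R > 0\<close>.\<close>
  moreover have "(fst a \<bullet> ?n) * (2 * ?R + ?w \<bullet> ?n) = 0"
    using arg_cong[OF eq, of "\<lambda>z. z \<bullet> ?n"] by (simp add: inner_add_left algebra_simps)
  ultimately have "fst a \<bullet> ?n = 0"
    using R by (simp add: add_pos_nonneg)
  with eq R have "fst a = 0"
    by simp
  with a2 show ?thesis
    by (simp add: prod_eq_iff)
qed

lemma nondegenerate_sigma:
  assumes m: "m \<in> M_reg"
  shows "nondegenerate2 (sigma m)"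
  unfolding nondegenerate2_def
proof (intro allI impI)
  fix a assume a: "\<forall>b. sigma m a b = 0"
  let ?F = "\<lambda>b. (p b, dq_map m b)"
  have lin: "linear ?F"
    by (rule linearI) (simp_all add: linear_add[OF linear_p] linear_add[OF linear_dq_map]
        linear_cmul[OF linear_p] linear_cmul[OF linear_dq_map])
  have "b = 0" if "?F b = 0" for b
    using arg_cong[OF that, of fst] arg_cong[OF that, of snd] by (intro inj_p_dq_map[OF m]) simp_all
  then have "inj ?F"
    unfolding linear_injective_0[OF lin] by blast
  with lin have "surj ?F"
    by (rule linear_injective_imp_surjective) (rule refl)
  \<comment> \<open>A quarter turn of (dp, dq) applied to \<open>a\<close>: pairing \<open>a\<close>
    with this \<open>b\<close> turns \<open>sigma\<close> into minus half a sum of squares.\<close>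
  from surjD[OF this, of "(- dq_map m a, p a)"] obtain b where "(- dq_map m a, p a) = ?F b"
    by blast
  then have "p b = - dq_map m a" "dq_map m b = p a"
    by auto
  with a[rule_format, of b] have "p a \<bullet> p a + dq_map m a \<bullet> dq_map m a = 0"
    by (simp add: sigma_def)
  then have "p a = 0" "dq_map m a = 0"
    by (simp_all add: add_nonneg_eq_0_iff)
  then show "a = 0"
    by (rule inj_p_dq_map[OF m])
qed

section \<open>Uniqueness of the descent\<close>

text \<open>The circle action on the fibre allows b = 0 and a >= 0, and then a^2 = (r + A)/2. If
  this vanishes, the target is (-r, 0, 0), reached with a = b = 0.\<close>

lemma hopf_surj:
  fixes A B C :: real
  obtains a b c d where "a\<^sup>2 + b\<^sup>2 - c\<^sup>2 - d\<^sup>2 = A" "2 * (a * c + b * d) = B" "2 * (a * d - b * c) = C"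
proof -
  define r where "r = sqrt (A\<^sup>2 + B\<^sup>2 + C\<^sup>2)"
  have r2: "r\<^sup>2 = A\<^sup>2 + B\<^sup>2 + C\<^sup>2"
    by (simp add: r_def)
  have "\<bar>A\<bar> \<le> r"
    unfolding r_def by (rule real_le_rsqrt) simp
  show ?thesis
  proof (cases "r + A > 0")
    case True
    define a where "a = sqrt ((r + A) / 2)"
    have a: "a > 0" "a\<^sup>2 = (r + A) / 2"
      using True by (simp_all add: a_def)
    have "(B / (2 * a))\<^sup>2 + (C / (2 * a))\<^sup>2 = (B\<^sup>2 + C\<^sup>2) / (4 * a\<^sup>2)"
      by (simp add: power_divide power_mult_distrib add_divide_distrib)
    also have "\<dots> = (r - A) / 2"
      using r2 True unfolding a(2) by (simp add: divide_simps) algebra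
    finally have "a\<^sup>2 + 0\<^sup>2 - (B / (2 * a))\<^sup>2 - (C / (2 * a))\<^sup>2 = A"
      unfolding a(2) zero_power2 by argo
    then show ?thesis
      using a(1) by (intro that[of a 0 "B / (2 * a)" "C / (2 * a)"]) auto
  next
    case False
    with \<open>\<bar>A\<bar> \<le> r\<close> have rA: "r = - A" and "r \<ge> 0"
      by linarith+
    then have "B\<^sup>2 + C\<^sup>2 = 0"
      using r2 by simp
    then have "B = 0" "C = 0"
      by (simp_all add: sum_power2_eq_zero_iff)
    with rA \<open>r \<ge> 0\<close> show ?thesis
      by (intro that[of 0 0 "sqrt r" 0]) auto
  qed
qed

text \<open>The rows of the Jacobian of the Hopf map are orthogonal of squared length \<open>4 (a\<^sup>2 + b\<^sup>2 + c\<^sup>2 + d\<^sup>2)\<close>, so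
  its rescaled transpose is a right inverse.\<close>

lemma hopf_deriv_surj:
  fixes a b c d A B C :: real
  assumes "a\<^sup>2 + b\<^sup>2 + c\<^sup>2 + d\<^sup>2 \<noteq> 0"
  obtains h k l m where "2 * (a * h + b * k - c * l - d * m) = A"
    "2 * (a * l + c * h + b * m + d * k) = B" "2 * (a * m + d * h - b * l - c * k) = C"
proof -
  let ?n = "a\<^sup>2 + b\<^sup>2 + c\<^sup>2 + d\<^sup>2"
  let ?h = "(a * A + c * B + d * C) / (2 * ?n)" and ?k = "(b * A + d * B - c * C) / (2 * ?n)"
    and ?l = "(a * B - c * A - b * C) / (2 * ?n)" and ?m = "(b * B - d * A + a * C) / (2 * ?n)"
  \<comment> \<open>Writing \<open>A\<close> as \<open>A * ?n / ?n\<close> puts the denominator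
    \<open>?n\<close> on both sides; it is cancelled at the end.\<close>
  have "2 * (a * ?h + b * ?k - c * ?l - d * ?m) = A * ?n / ?n"
    "2 * (a * ?l + c * ?h + b * ?m + d * ?k) = B * ?n / ?n"
    "2 * (a * ?m + d * ?h - b * ?l - c * ?k) = C * ?n / ?n"
    using assms by (simp_all add: divide_simps del: nonzero_mult_div_cancel_right) algebra+
  then show ?thesis
    unfolding nonzero_mult_div_cancel_right[OF assms] by (rule that)
qed

lemma R8_cases:
  obtains x :: R8 where "x$0 = a0" "x$1 = a1" "x$2 = a2" "x$3 = a3" "x$4 = a4" "x$5 = a5" "x$6 = a6" "x$7 = a7"
proof
  let ?x = "a0 *\<^sub>R pd 0 + a1 *\<^sub>R pd 1 + a2 *\<^sub>R pd 2 + a3 *\<^sub>R pd 3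
    + a4 *\<^sub>R pd 4 + a5 *\<^sub>R pd 5 + a6 *\<^sub>R pd 6 + a7 *\<^sub>R pd 7"
  show "?x$0 = a0" "?x$1 = a1" "?x$2 = a2" "?x$3 = a3" "?x$4 = a4" "?x$5 = a5" "?x$6 = a6" "?x$7 = a7"
    by (simp_all add: pd_def axis_def)
qed

lemma surj_Q: "surj Q"
proof -
  have "\<exists>x. Q x = m" for m :: R6
  proof -
    obtain a b c d where 1: "a\<^sup>2 + b\<^sup>2 - c\<^sup>2 - d\<^sup>2 = fst m $ 1"
      "2 * (a * c + b * d) = fst m $ 2" "2 * (a * d - b * c) = fst m $ 3"
      by (rule hopf_surj)
    obtain a' b' c' d' where 2: "a'\<^sup>2 + b'\<^sup>2 - c'\<^sup>2 - d'\<^sup>2 = snd m $ 1"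
      "2 * (a' * c' + b' * d') = snd m $ 2" "2 * (a' * d' - b' * c') = snd m $ 3"
      by (rule hopf_surj)
    \<comment> \<open>The two Hopf maps use the disjoint coordinates 0, 1, 4, 5 and 2, 3, 6,
      7.\<close>
    obtain x :: R8 where "x$0 = a" "x$1 = b" "x$2 = a'" "x$3 = b'" "x$4 = c" "x$5 = d" "x$6 = c'" "x$7 = d'"
      by (rule R8_cases)
    with 1 2 have "Q x = m"
      by (simp add: Q_def prod_eq_iff vec_eq_iff forall_3)
    then show ?thesis ..
  qed
  then show ?thesis
    by (metis surj_def)
qed

lemma surj_dQ_map:
  assumes "Q x \<in> M_reg"
  shows "surj (dQ_map x)"
proof -
  have "\<exists>y. dQ_map x y = m" for m :: R6
  proof -
    have "unorm (Q x) \<noteq> 0" "vnorm (Q x) \<noteq> 0"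
      using assms by (auto simp: M_reg_iff unorm_def vnorm_def)
    note nz = this[unfolded unorm_Q vnorm_Q]
    obtain h k l n where 1: "2 * (x$0 * h + x$1 * k - x$4 * l - x$5 * n) = fst m $ 1"
      "2 * (x$0 * l + x$4 * h + x$1 * n + x$5 * k) = fst m $ 2"
      "2 * (x$0 * n + x$5 * h - x$1 * l - x$4 * k) = fst m $ 3"
      using nz(1) by (rule hopf_deriv_surj)
    obtain h' k' l' n' where 2: "2 * (x$2 * h' + x$3 * k' - x$6 * l' - x$7 * n') = snd m $ 1"
      "2 * (x$2 * l' + x$6 * h' + x$3 * n' + x$7 * k') = snd m $ 2"
      "2 * (x$2 * n' + x$7 * h' - x$3 * l' - x$6 * k') = snd m $ 3"
      using nz(2) by (rule hopf_deriv_surj)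
    obtain y :: R8 where "y$0 = h" "y$1 = k" "y$2 = h'" "y$3 = k'" "y$4 = l" "y$5 = n" "y$6 = l'" "y$7 = n'"
      by (rule R8_cases)
    with 1 2 have "dQ_map x y = m"
      by (simp add: dQ_map_def prod_eq_iff vec_eq_iff forall_3)
    then show ?thesis ..
  qed
  then show ?thesis
    by (metis surj_def)
qed

lemma descends_sigma: "descends_to M_reg Q (interior_prod X phi) sigma"
  unfolding descends_to_def using alternating_sigma pullback_sigma interior_prod_X_phi by simp

text \<open>Pullback along a surjective submersion is injective on forms: points and tangent vectors
  of \<open>M_reg\<close> lift through \<open>Q\<close> and \<open>dQ_map\<close>.\<close>

lemma descent_unique:
  assumes \<sigma>: "descends_to M_reg Q \<beta> \<sigma>" and \<tau>: "descends_to M_reg Q \<beta> \<tau>" and m: "m \<in> M_reg"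
  shows "\<sigma> m = \<tau> m"
proof (intro ext)
  fix a b
  obtain x where x: "Q x = m"
    using surj_Q by (metis surjD)
  obtain v w where vw: "dQ_map x v = a" "dQ_map x w = b"
    using surj_dQ_map[of x] m x by (metis surjD)
  have "pullback2 Q \<sigma> x v w = pullback2 Q \<tau> x v w"
    using \<sigma> \<tau> m x by (simp add: descends_to_def)
  then show "\<sigma> m a b = \<tau> m a b"
    by (simp add: pullback2_def frechet_derivative_at[OF has_derivative_Q, symmetric] x vw)
qed

theorem theorem7p2:
  shows "(\<forall>x v w. x \<noteq> 0 \<longrightarrow>
            interior_prod X phi x v w =
              - (1/2) * (\<Sum>i\<in>UNIV. wedge (d0 (\<lambda>y. p (Q y) $ i)) (d0 (\<lambda>y. q (Q y) $ i)) x v w))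
       \<and> (\<exists>\<sigma>. descends_to M_reg Q (interior_prod X phi) \<sigma>)
       \<and> (\<forall>\<sigma>. descends_to M_reg Q (interior_prod X phi) \<sigma> \<longrightarrow>
            (\<forall>m\<in>M_reg.
               (\<forall>a b. \<sigma> m a b =
                  - (1/2) * (\<Sum>i\<in>UNIV. wedge (d0 (\<lambda>n. p n $ i)) (d0 (\<lambda>n. q n $ i)) m a b))
               \<and> nondegenerate2 (\<sigma> m)))"
proof (intro conjI allI impI ballI)
  show "interior_prod X phi x v w =
      - (1/2) * (\<Sum>i\<in>UNIV. wedge (d0 (\<lambda>y. p (Q y) $ i)) (d0 (\<lambda>y. q (Q y) $ i)) x v w)" for x v w
    by (rule interior_prod_X_phi)
  show "\<exists>\<sigma>. descends_to M_reg Q (interior_prod X phi) \<sigma>"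
    by (rule exI, rule descends_sigma)
  fix \<sigma> m
  assume "descends_to M_reg Q (interior_prod X phi) \<sigma>" and m: "m \<in> M_reg"
  then have *: "\<sigma> m = sigma m"
    by (rule descent_unique[OF _ descends_sigma])
  show "\<sigma> m a b = - (1/2) * (\<Sum>i\<in>UNIV. wedge (d0 (\<lambda>n. p n $ i)) (d0 (\<lambda>n. q n $ i)) m a b)" for a b
    unfolding * sigma_eq[OF m] ..
  show "nondegenerate2 (\<sigma> m)"
    unfolding * by (rule nondegenerate_sigma[OF m])
qed

end
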